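(* There exist absolute constants $c>0$ and $n_0$ such that for every $n\ge n_0$ and every $p$ with $10^{-6}\le p\le 1-10^{-6}$, if $G\sim G(n,p)$ then $$\mathbb{P}(G\text{ is even-non-decomposable})\le e^{-cn^2}.$$ In particular, for $G\sim G(n,1/2)$ the probability that $G$ is even-non-decomposable is $e^{-\Omega(n^2)}$.
   Context: $G(n,p)$ is the binomial random graph on $n$ labelled vertices in which each pair is an edge independently with probability $p$. A graph $H$ is even-decomposable if there is a sequence $V(H)=V_0\supset V_1\supset\cdots\supset V_k=\emptyset$ such that for each $0\le i\le k-1$, the induced subgraph $H[V_i]$ has an even number of edges and $V_i\setminus V_{i+1}$ is an independent set in $H$. A graph is even-non-decomposable if it has an even number of edges but is not even-decomposable. *)

theory Defs
  imports Complex_Main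
begin

text \<open>Simple graphs on the labelled vertex set {..<n} are represented by their edge set:
  a set of 2-element subsets of {..<n}.\<close>

definition all_pairs :: "nat \<Rightarrow> nat set set" where
  "all_pairs n = {e. e \<subseteq> {..<n} \<and> card e = 2}"

definition induced_edges :: "nat set set \<Rightarrow> nat set \<Rightarrow> nat set set" where
  "induced_edges E W = {e \<in> E. e \<subseteq> W}"

definition independent_set :: "nat set set \<Rightarrow> nat set \<Rightarrow> bool" where
  "independent_set E S \<longleftrightarrow> (\<forall>e\<in>E. \<not> e \<subseteq> S)"

definition even_decomposable :: "nat \<Rightarrow> nat set set \<Rightarrow> bool" where
  "even_decomposable n E \<longleftrightarrow>
     (\<exists>(k::nat) (V::nat \<Rightarrow> nat set). V 0 = {..<n} \<and> V k = {} \<and>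
        (\<forall>i<k. V (Suc i) \<subset> V i \<and> even (card (induced_edges E (V i))) \<and>
               independent_set E (V i - V (Suc i))))"

definition even_non_decomposable :: "nat \<Rightarrow> nat set set \<Rightarrow> bool" where
  "even_non_decomposable n E \<longleftrightarrow> even (card E) \<and> \<not> even_decomposable n E"

definition gnp_prob :: "nat \<Rightarrow> real \<Rightarrow> (nat set set \<Rightarrow> bool) \<Rightarrow> real" where
  "gnp_prob n p P =
     (\<Sum>E\<in>{E. E \<subseteq> all_pairs n \<and> P E}.
        p ^ card E * (1 - p) ^ (card (all_pairs n) - card E))"

end

theory Submission
  imports Defs
begin

text \<open>Deleting vertices of even degree and nonadjacent pairs of odd-degree vertices from a graph with
  evenly many edges can only get stuck at a clique. An induced pair of disjoint edges, with whatever
  degree parities and whatever adjacencies to the rest, allows any further vertex to be deleted at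
  the cost of some of these four vertices. An induced matching of six edges (a gadget) therefore
  deletes three given vertices, and what remains of it is triangle-free, so that a greedy deletion
  leaves at most two of its vertices: a leftover set of size at least three shrinks. Hence if all
  but few vertices are covered by disjoint gadgets, the last gadget leaves an even graph on at most
  two vertices with all degrees odd, i.e. nothing.
  A set of linear size contains quadratically many pairwise edge-disjoint places for a gadget, so
  with probability \<open>1 - exp (- c n\<^sup>2)\<close> every set of \<open>n div 20\<close> vertices contains a gadget, and
  such a covering can be chosen greedily.\<close>

section \<open>Decompositions from disjoint gadgets\<close>

locale pair_graph =
  fixes E :: "nat set set"
  assumes card_edge: "e \<in> E \<Longrightarrow> card e = 2"
begin

abbreviation adj :: "nat \<Rightarrow> nat \<Rightarrow> bool" where
  "adj x y \<equiv> {x, y} \<in> E"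

definition even_graph :: "nat set \<Rightarrow> bool" where
  "even_graph V \<longleftrightarrow> even (card (induced_edges E V))"

definition odd_deg :: "nat set \<Rightarrow> nat \<Rightarrow> bool" where
  "odd_deg V v \<longleftrightarrow> odd (card {w \<in> V. adj v w})"

text \<open>Evenness is demanded at both ends, so that it is carried along \<open>reach\<close>. A
  path from the full vertex set to the empty set is then an even decomposition.\<close>

definition step :: "nat set \<Rightarrow> nat set \<Rightarrow> bool" where
  "step V W \<longleftrightarrow> W \<subset> V \<and> even_graph V \<and> even_graph W \<and> independent_set E (V - W)"

abbreviation reach :: "nat set \<Rightarrow> nat set \<Rightarrow> bool" where
  "reach \<equiv> step\<^sup>*\<^sup>*"

lemma not_adj_self [simp]: "{x} \<notin> E"
  using card_edge[of "{x}"] by auto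

lemma adj_neq: "adj x y \<Longrightarrow> x \<noteq> y"
  by auto

section \<open>Parity of edge counts and degrees under vertex deletion\<close>

lemma even_graph_empty: "even_graph {}"
proof -
  have "induced_edges E {} = {}"
    unfolding induced_edges_def using card_edge by fastforce
  then show ?thesis by (simp add: even_graph_def)
qed

lemma card_induced_edges_remove:
  assumes "finite V" "v \<in> V"
  shows "card (induced_edges E V) = card (induced_edges E (V - {v})) + card {w \<in> V. adj v w}"
proof -
  let ?S = "(\<lambda>w. {v, w}) ` {w \<in> V. adj v w}"
  have fin: "finite (induced_edges E V)"
    unfolding induced_edges_def using assms(1) by (auto intro: finite_subset[of _ "Pow V"])
  have "induced_edges E V \<subseteq> induced_edges E (V - {v}) \<union> ?S"
  proof
    fix e assume e: "e \<in> induced_edges E V"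
    show "e \<in> induced_edges E (V - {v}) \<union> ?S"
    proof (cases "v \<in> e")
      case True
      moreover have "card e = 2" using e card_edge by (auto simp: induced_edges_def)
      ultimately obtain w where "e = {v, w}" by (auto simp: card_2_iff)
      then show ?thesis using e by (auto simp: induced_edges_def)
    next
      case False
      then show ?thesis using e by (auto simp: induced_edges_def)
    qed
  qed
  moreover have "induced_edges E (V - {v}) \<union> ?S \<subseteq> induced_edges E V"
    using assms(2) by (auto simp: induced_edges_def)
  ultimately have eq: "induced_edges E V = induced_edges E (V - {v}) \<union> ?S" by blast
  have "induced_edges E (V - {v}) \<inter> ?S = {}"
    by (auto simp: induced_edges_def)
  then have "card (induced_edges E V) = card (induced_edges E (V - {v})) + card ?S"
    using fin unfolding eq by (intro card_Un_disjoint) auto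
  moreover have "card ?S = card {w \<in> V. adj v w}"
    by (intro card_image inj_onI) (auto simp: doubleton_eq_iff)
  ultimately show ?thesis by simp
qed

lemma even_graph_remove:
  "finite V \<Longrightarrow> v \<in> V \<Longrightarrow> even_graph (V - {v}) \<longleftrightarrow> (even_graph V \<longleftrightarrow> \<not> odd_deg V v)"
  using card_induced_edges_remove[of V v] by (auto simp: even_graph_def odd_deg_def)

lemma odd_deg_remove:
  assumes "finite V" "x \<in> V"
  shows "odd_deg (V - {x}) v \<longleftrightarrow> (odd_deg V v \<longleftrightarrow> \<not> adj v x)"
proof (cases "adj v x")
  case True
  have "{w \<in> V. adj v w} = insert x {w \<in> V - {x}. adj v w}" using True assms(2) by auto
  then have "card {w \<in> V. adj v w} = Suc (card {w \<in> V - {x}. adj v w})"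
    using assms(1) by simp
  then show ?thesis using True by (simp add: odd_deg_def)
next
  case False
  have "{w \<in> V - {x}. adj v w} = {w \<in> V. adj v w}" using False by auto
  then show ?thesis using False by (simp add: odd_deg_def)
qed

lemma step_remove1:
  assumes "finite V" "even_graph V" "v \<in> V" "\<not> odd_deg V v"
  shows "step V (V - {v})"
proof -
  have "V - (V - {v}) = {v}" using assms(3) by auto
  moreover have "independent_set E {v}"
    unfolding independent_set_def using card_edge by (fastforce dest: subset_singletonD)
  ultimately show ?thesis
    using assms even_graph_remove[of V v] by (auto simp: step_def)
qed

text \<open>Since \<open>u\<close> and \<open>v\<close> are not adjacent, deleting \<open>u\<close>
  leaves the degree of \<open>v\<close> odd. Each of the two deletions flips the parity of the edge
  count, and the flips cancel.\<close>

lemma step_remove2: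
  assumes "finite V" "even_graph V" "u \<in> V" "v \<in> V" "u \<noteq> v" "\<not> adj u v"
    "odd_deg V u" "odd_deg V v"
  shows "step V (V - {u, v})"
proof -
  have eq: "V - {u, v} = (V - {u}) - {v}" by auto
  have "odd_deg (V - {u}) v"
    using assms odd_deg_remove[of V u v] by (simp add: insert_commute)
  then have "even_graph (V - {u, v})"
    unfolding eq using assms even_graph_remove[of V u] even_graph_remove[of "V - {u}" v] by auto
  moreover have "V - (V - {u, v}) = {u, v}" using assms by auto
  moreover have "independent_set E {u, v}"
    unfolding independent_set_def
  proof (intro ballI notI)
    fix e assume e: "e \<in> E" "e \<subseteq> {u, v}"
    then have "e = {u, v}"
      using card_edge[OF e(1)] \<open>u \<noteq> v\<close> by (intro card_subset_eq) auto
    then show False using e assms(6) by simp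
  qed
  ultimately show ?thesis using assms by (auto simp: step_def)
qed

lemma reach_even_graph: "reach V W \<Longrightarrow> even_graph V \<Longrightarrow> even_graph W"
  by (induction rule: rtranclp_induct) (auto simp: step_def)

lemma reach_subset: "reach V W \<Longrightarrow> W \<subseteq> V"
  by (induction rule: rtranclp_induct) (auto simp: step_def)

text \<open>Only vertices of \<open>Z\<close> may be deleted, while degrees are counted in the whole
  current graph. As long as \<open>Z\<close> contains a vertex of even degree or two nonadjacent
  vertices of odd degree, a step inside \<open>Z\<close> is possible; once it is stuck, the
  survivors of \<open>Z\<close> form a clique of odd-degree vertices.\<close>

lemma greedy:
  assumes "finite V" "even_graph V" "Z \<subseteq> V"
  shows "\<exists>W. reach V W \<and> V - Z \<subseteq> W \<and> (\<forall>x\<in>W \<inter> Z. odd_deg W x) \<and>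
           (\<forall>x\<in>W \<inter> Z. \<forall>y\<in>W \<inter> Z. x \<noteq> y \<longrightarrow> adj x y)"
  using assms
proof (induction "card V" arbitrary: V Z rule: less_induct)
  case less
  \<comment> \<open>After one admissible deletion of a subset \<open>S\<close> of \<open>Z\<close>,
    induction applies to \<open>V - S\<close> and \<open>Z - S\<close>; the part outside
    \<open>Z\<close> is unchanged.\<close>
  have rec: ?case if "step V (V - S)" "S \<subseteq> Z" for S
  proof -
    have "V - S \<subset> V" "even_graph (V - S)" using that(1) by (auto simp: step_def)
    moreover from this have "card (V - S) < card V" using less.prems(1) psubset_card_mono by blast
    ultimately obtain W where W: "reach (V - S) W" "(V - S) - (Z - S) \<subseteq> W"
      "\<forall>x\<in>W \<inter> (Z - S). odd_deg W x"
      "\<forall>x\<in>W \<inter> (Z - S). \<forall>y\<in>W \<inter> (Z - S). x \<noteq> y \<longrightarrow> adj x y"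
      using less.hyps[of "V - S" "Z - S"] less.prems by blast
    moreover have "W \<inter> (Z - S) = W \<inter> Z" using reach_subset[OF W(1)] by auto
    moreover have "(V - S) - (Z - S) = V - Z" using that(2) by auto
    ultimately show ?thesis
      using converse_rtranclp_into_rtranclp[of step, OF that(1) W(1)] by auto
  qed
  show ?case
  proof (cases "\<exists>v\<in>Z. \<not> odd_deg V v")
    case True
    then obtain v where "v \<in> Z" "\<not> odd_deg V v" by auto
    then show ?thesis
      using rec[of "{v}"] step_remove1[of V v] less.prems by auto
  next
    case all_odd: False
    show ?thesis
    proof (cases "\<exists>u\<in>Z. \<exists>v\<in>Z. u \<noteq> v \<and> \<not> adj u v")
      case True
      then obtain u v where "u \<in> Z" "v \<in> Z" "u \<noteq> v" "\<not> adj u v" by auto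
      then show ?thesis
        using rec[of "{u, v}"] step_remove2[of V u v] less.prems all_odd by blast
    next
      case False
      then show ?thesis using all_odd by (intro exI[of _ V]) auto
    qed
  qed
qed

section \<open>Deleting a prescribed vertex with the help of a few others\<close>

text \<open>A useful helper \<open>a\<close> is a neighbour of even degree or a nonneighbour of odd
  degree. If \<open>u\<close> has even degree, it goes alone. Otherwise deleting an even neighbour
  \<open>a\<close> first makes the degree of \<open>u\<close> even, and an odd nonneighbour
  \<open>a\<close> can be deleted together with \<open>u\<close>.\<close>

lemma kill_with_vertex:
  assumes "finite V" "even_graph V" "u \<in> V" "a \<in> V" "u \<noteq> a" "adj u a \<longleftrightarrow> \<not> odd_deg V a"
  shows "\<exists>W. reach V W \<and> u \<notin> W \<and> V - {u, a} \<subseteq> W"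
proof (cases "odd_deg V u")
  case False
  then have "step V (V - {u})" using assms step_remove1 by simp
  then show ?thesis by (intro exI[of _ "V - {u}"]) auto
next
  case odd: True
  show ?thesis
  proof (cases "adj u a")
    case True
    then have s: "step V (V - {a})" using assms step_remove1 by simp
    moreover have "\<not> odd_deg (V - {a}) u" using odd_deg_remove[of V a u] assms odd True by simp
    ultimately have "step (V - {a}) (V - {a} - {u})"
      using assms step_remove1[of "V - {a}" u] by (auto simp: step_def)
    with s have "reach V (V - {a} - {u})" by auto
    then show ?thesis by (intro exI[of _ "V - {a} - {u}"]) auto
  next
    case False
    then have "step V (V - {u, a})" using assms odd step_remove2 by simp
    then show ?thesis by (intro exI[of _ "V - {u, a}"]) auto
  qed
qed

text \<open>If neither \<open>a\<close> nor \<open>b\<close> is a suitable helper as it stands,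
  deleting the even vertex \<open>a\<close> flips the degree parity of its neighbour
  \<open>b\<close> and so turns \<open>b\<close> into one.\<close>

lemma kill_with_edge:
  assumes V: "finite V" "even_graph V" "u \<in> V" "a \<in> V" "b \<in> V" "u \<noteq> a" "u \<noteq> b"
    and ab: "adj a b" "\<not> odd_deg V a"
  shows "\<exists>W. reach V W \<and> u \<notin> W \<and> V - {u, a, b} \<subseteq> W"
proof -
  consider "adj u a" | "adj u b \<longleftrightarrow> \<not> odd_deg V b" | "\<not> adj u a" "adj u b \<longleftrightarrow> odd_deg V b"
    by blast
  then show ?thesis
  proof cases
    case 1
    then show ?thesis using kill_with_vertex[of V u a] V ab by blast
  next
    case 2
    then show ?thesis using kill_with_vertex[of V u b] V ab by blast
  next
    case 3
    have s: "step V (V - {a})" using V ab step_remove1 by simp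
    have "odd_deg (V - {a}) b \<longleftrightarrow> \<not> odd_deg V b"
      using odd_deg_remove[of V a b] V ab by (simp add: insert_commute)
    then obtain W where "reach (V - {a}) W" "u \<notin> W" "V - {a} - {u, b} \<subseteq> W"
      using kill_with_vertex[of "V - {a}" u b] V 3 s adj_neq[OF ab(1)] by (auto simp: step_def)
    with s show ?thesis
      by (intro exI[of _ W]) (auto intro: converse_rtranclp_into_rtranclp)
  qed
qed

definition two_edges :: "nat set \<Rightarrow> bool" where
  "two_edges A \<longleftrightarrow> (\<exists>a b c d. A = {a, b, c, d} \<and> distinct [a, b, c, d] \<and> adj a b \<and> adj c d \<and>
     \<not> adj a c \<and> \<not> adj a d \<and> \<not> adj b c \<and> \<not> adj b d)"

text \<open>If some vertex of \<open>A\<close> has even degree, the edge at it suffices. When all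
  four degrees are odd, the absence of edges between the two pairs permits the joint deletion of
  \<open>a\<close> and \<open>c\<close>.\<close>

lemma kill_with_two_edges:
  assumes V: "finite V" "even_graph V" "u \<in> V" "A \<subseteq> V" "u \<notin> A" and "two_edges A"
  shows "\<exists>W. reach V W \<and> u \<notin> W \<and> V - insert u A \<subseteq> W"
proof -
  obtain a b c d where A: "A = {a, b, c, d}" and dist: "distinct [a, b, c, d]"
    and e: "adj a b" "adj c d" and ne: "\<not> adj a c" "\<not> adj a d" "\<not> adj b c" "\<not> adj b d"
    using \<open>two_edges A\<close> unfolding two_edges_def by blast
  have sym: "adj b a" "adj d c" using e by (simp_all add: insert_commute)
  have even_case: ?thesis if xy: "adj x y" "x \<in> A" "y \<in> A" "\<not> odd_deg V x" for x y
  proof -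
    obtain W where "reach V W" "u \<notin> W" "V - {u, x, y} \<subseteq> W"
      using kill_with_edge[of V u x y] xy V by blast
    then show ?thesis using xy by (intro exI[of _ W]) auto
  qed
  show ?thesis
  proof (cases "\<exists>x\<in>A. \<not> odd_deg V x")
    case True
    then show ?thesis using even_case e sym A by blast
  next
    case all_odd: False
    \<comment> \<open>Deleting \<open>a\<close> and \<open>c\<close> changes the parity of \<open>b\<close> but not its adjacency to \<open>u\<close>.\<close>
    show ?thesis
    proof (cases "adj u b")
      case False
      then obtain W where "reach V W" "u \<notin> W" "V - {u, b} \<subseteq> W"
        using kill_with_vertex[of V u b] V all_odd A by blast
      then show ?thesis using A by (intro exI[of _ W]) auto
    next
      case True
      have s: "step V (V - {a, c})"
        using step_remove2[of V a c] V all_odd A dist ne by auto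
      have "V - {a, c} = (V - {a}) - {c}" by auto
      then have "\<not> odd_deg (V - {a, c}) b"
        using odd_deg_remove[of V a b] odd_deg_remove[of "V - {a}" c b] V A dist sym ne all_odd
        by auto
      then obtain W where "reach (V - {a, c}) W" "u \<notin> W" "V - {a, c} - {u, b} \<subseteq> W"
        using kill_with_vertex[of "V - {a, c}" u b] V True s A dist by (auto simp: step_def)
      with s show ?thesis
        using A by (intro exI[of _ W]) (auto intro: converse_rtranclp_into_rtranclp)
    qed
  qed
qed

text \<open>Each vertex \<open>u\<close> of \<open>X\<close> consumes one member of
  \<open>As\<close>. Its deletion costs nothing outside that member, so by disjointness the other
  members and the rest of \<open>X\<close> are still intact for the next round.\<close>

lemma kill_set:
  assumes "finite V" "even_graph V" "X \<subseteq> V" "\<forall>A\<in>set As. two_edges A \<and> A \<subseteq> V \<and> A \<inter> X = {}"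
    "pairwise disjnt (set As)" "distinct As" "card X \<le> length As"
  shows "\<exists>W. reach V W \<and> W \<inter> X = {} \<and> V - (X \<union> \<Union>(set As)) \<subseteq> W"
  using assms
proof (induction As arbitrary: V X)
  case Nil
  then have "X = {}" using finite_subset by force
  then show ?case by (intro exI[of _ V]) auto
next
  case (Cons A As)
  show ?case
  proof (cases "X = {}")
    case True
    then show ?thesis by (intro exI[of _ V]) auto
  next
    case False
    then obtain u where u: "u \<in> X" by auto
    obtain V' where V': "reach V V'" "u \<notin> V'" "V - insert u A \<subseteq> V'"
      using kill_with_two_edges[of V u A] Cons.prems u by auto
    have disj: "A \<inter> B = {}" if "B \<in> set As" for B
      using Cons.prems(5,6) that by (auto simp: pairwise_insert disjnt_def)
    have "\<exists>W. reach V' W \<and> W \<inter> (X - {u}) = {} \<and> V' - (X - {u} \<union> \<Union>(set As)) \<subseteq> W"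
    proof (rule Cons.IH)
      show "finite V'" using reach_subset[OF V'(1)] Cons.prems(1) finite_subset by blast
      show "even_graph V'" using reach_even_graph V' Cons.prems by blast
      show "X - {u} \<subseteq> V'" using V'(3) Cons.prems(3,4) by auto
      show "\<forall>B\<in>set As. two_edges B \<and> B \<subseteq> V' \<and> B \<inter> (X - {u}) = {}"
      proof
        fix B assume B: "B \<in> set As"
        then have "B \<subseteq> V" "B \<inter> X = {}" "two_edges B" using Cons.prems(4) by auto
        then show "two_edges B \<and> B \<subseteq> V' \<and> B \<inter> (X - {u}) = {}"
          using disj[OF B] V'(3) u by blast
      qed
      show "pairwise disjnt (set As)" using Cons.prems(5) by (simp add: pairwise_insert)
      show "distinct As" using Cons.prems(6) by simp
      show "card (X - {u}) \<le> length As"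
        using Cons.prems(7) u finite_subset[OF Cons.prems(3,1)] by (simp add: card_Diff_singleton)
    qed
    then obtain W where W: "reach V' W" "W \<inter> (X - {u}) = {}"
      "V' - (X - {u} \<union> \<Union>(set As)) \<subseteq> W" by blast
    have "W \<inter> X = {}" using W(2) reach_subset[OF W(1)] V'(2) by auto
    moreover have "V - (X \<union> \<Union>(set (A # As))) \<subseteq> W" using V'(3) W(3) u by auto
    moreover have "reach V W" using V'(1) W(1) by simp
    ultimately show ?thesis by blast
  qed
qed

section \<open>Gadgets: induced matchings that absorb leftover vertices\<close>

text \<open>The matching edges join the images of \<open>2*k\<close> and \<open>2*k+1\<close>, so
  that \<open>i div 2\<close> names the edge containing \<open>f i\<close>. Six edges make three
  sets with \<open>two_edges\<close>, enough for three prescribed deletions.\<close>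

definition gadget :: "nat set \<Rightarrow> bool" where
  "gadget F \<longleftrightarrow> (\<exists>f. inj_on f {..<12::nat} \<and> F = f ` {..<12} \<and>
     (\<forall>i<12. \<forall>j<12. adj (f i) (f j) \<longleftrightarrow> i \<noteq> j \<and> i div 2 = j div 2))"

lemma gadget_finite: "gadget F \<Longrightarrow> finite F"
  and gadget_card: "gadget F \<Longrightarrow> card F = 12"
  by (auto simp: gadget_def card_image)

text \<open>All vertices of a clique in a matching lie on one edge; three of them would give three
  distinct indices with the same half.\<close>

lemma gadget_clique_card:
  assumes "gadget F" "C \<subseteq> F" "\<forall>x\<in>C. \<forall>y\<in>C. x \<noteq> y \<longrightarrow> adj x y"
  shows "card C \<le> 2"
proof (rule ccontr)
  assume "\<not> card C \<le> 2"
  then obtain T where "T \<subseteq> C" "card T = 3"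
    using obtain_subset_with_card_n[of 3 C] by auto
  then obtain x y z where xyz: "x \<in> C" "y \<in> C" "z \<in> C" "x \<noteq> y" "x \<noteq> z" "y \<noteq> z"
    by (auto simp: card_3_iff)
  obtain f where f: "inj_on f {..<12::nat}" "F = f ` {..<12}"
     "\<forall>i<12. \<forall>j<12. adj (f i) (f j) \<longleftrightarrow> i \<noteq> j \<and> i div 2 = j div 2"
    using assms(1) by (auto simp: gadget_def)
  obtain i j k where ijk: "i < 12" "j < 12" "k < 12" "x = f i" "y = f j" "z = f k"
    using subsetD[OF assms(2) xyz(1)] subsetD[OF assms(2) xyz(2)] subsetD[OF assms(2) xyz(3)]
    unfolding f(2) by (elim imageE) simp
  have "adj x y" "adj x z" using xyz assms(3) by auto
  then have d: "i div 2 = j div 2" "i div 2 = k div 2"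
    using ijk f(3) by metis+
  have "i \<noteq> j" "i \<noteq> k" "j \<noteq> k" using xyz ijk by auto
  with d show False by linarith
qed

lemma gadget_two_edges:
  assumes "gadget F"
  obtains As where "length As = 3" "distinct As" "pairwise disjnt (set As)"
    "\<forall>A\<in>set As. two_edges A \<and> A \<subseteq> F"
proof -
  obtain f where f: "inj_on f {..<12::nat}" "F = f ` {..<12}"
     "\<And>i j. i < 12 \<Longrightarrow> j < 12 \<Longrightarrow> adj (f i) (f j) \<longleftrightarrow> i \<noteq> j \<and> i div 2 = j div 2"
    using assms by (auto simp: gadget_def)
  have inj: "f i = f j \<longleftrightarrow> i = j" if "i < 12" "j < 12" for i j
    using f(1) that by (auto simp: inj_on_def)
  \<comment> \<open>Two consecutive matching edges occupy four consecutive indices, so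
    \<open>i div 4\<close> tells which of the three sets contains \<open>f i\<close>.\<close>
  define A where "A k = {f (4*k), f (4*k+1), f (4*k+2), f (4*k+3)}" for k
  have in_A: "\<exists>i<12. i div 4 = k \<and> x = f i" if "x \<in> A k" "k < 3" for x k
  proof -
    have "x = f (4*k) \<or> x = f (4*k+1) \<or> x = f (4*k+2) \<or> x = f (4*k+3)"
      using that(1) by (auto simp: A_def)
    moreover have "\<exists>r<4. x = f (4*k+r)" if "x = f (4*k+s)" "s < 4" for s
      using that by blast
    ultimately obtain r where r: "r < 4" "x = f (4*k+r)"
      by (metis Nat.add_0_right one_less_numeral_iff numeral_less_iff zero_less_numeral
          semiring_norm(76,77,78,79,81))
    then show ?thesis using that(2) by (intro exI[of _ "4*k+r"]) simp
  qed
  have two: "two_edges (A k) \<and> A k \<subseteq> F" if "k < 3" for k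
  proof
    show "two_edges (A k)"
      unfolding two_edges_def A_def
      by (rule exI[of _ "f (4*k)"], rule exI[of _ "f (4*k+1)"], rule exI[of _ "f (4*k+2)"],
          rule exI[of _ "f (4*k+3)"]) (use that in \<open>simp add: inj f(3), presburger\<close>)
    show "A k \<subseteq> F" using in_A[OF _ that] f(2) by blast
  qed
  have disj: "disjnt (A k) (A l)" if "k < 3" "l < 3" "k \<noteq> l" for k l
  proof (rule ccontr)
    assume "\<not> disjnt (A k) (A l)"
    then obtain x where "x \<in> A k" "x \<in> A l" by (auto simp: disjnt_def)
    then obtain i j where "i < 12" "i div 4 = k" "x = f i" "j < 12" "j div 4 = l" "x = f j"
      using in_A \<open>k < 3\<close> \<open>l < 3\<close> by meson
    then show False using inj[of i j] \<open>k \<noteq> l\<close> by simp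
  qed
  have ne: "A k \<noteq> A l" if "k < 3" "l < 3" "k \<noteq> l" for k l
    using disj[OF that] by (auto simp: A_def)
  show thesis
  proof (rule that[of "[A 0, A 1, A 2]"])
    show "distinct [A 0, A 1, A 2]" using ne by auto
    show "pairwise disjnt (set [A 0, A 1, A 2])" using disj by (auto simp: pairwise_insert)
  qed (use two in auto)
qed

text \<open>The gadget deletes three vertices of \<open>X\<close> and leaves at most two of its own,
  so a leftover set of size at least three loses at least one vertex. The odd degrees of the
  survivors are recorded for \<open>small_odd_graph_empty\<close>.\<close>

lemma gadget_absorb:
  assumes V: "finite V" "even_graph V" "X \<subseteq> V" "F \<subseteq> V" "X \<inter> F = {}" and F: "gadget F"
  obtains W where "reach V W" "V - (X \<union> F) \<subseteq> W" "card (W \<inter> (X \<union> F)) \<le> max 2 (card X - 1)"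
    "\<forall>x\<in>W \<inter> (X \<union> F). odd_deg W x"
proof -
  have finX: "finite X" using V finite_subset by blast
  obtain As where As: "length As = 3" "distinct As" "pairwise disjnt (set As)"
    "\<forall>A\<in>set As. two_edges A \<and> A \<subseteq> F" using gadget_two_edges[OF F] .
  \<comment> \<open>Three is the number of deletions that \<open>As\<close> can pay for; the minimum
    covers the case of a smaller \<open>X\<close>.\<close>
  obtain X0 where X0: "X0 \<subseteq> X" "card X0 = min 3 (card X)"
    using obtain_subset_with_card_n[of "min 3 (card X)" X] by auto
  obtain V' where V': "reach V V'" "V' \<inter> X0 = {}" "V - (X0 \<union> \<Union>(set As)) \<subseteq> V'"
  proof -
    have "\<forall>A\<in>set As. two_edges A \<and> A \<subseteq> V \<and> A \<inter> X0 = {}" using As(4) V X0(1) by blast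
    moreover have "X0 \<subseteq> V" using X0(1) V(3) by blast
    ultimately show thesis
      using that kill_set[OF V(1,2) _ _ As(3,2), of X0] As(1) X0(2) by auto
  qed
  have fin': "finite V'" using reach_subset[OF V'(1)] V(1) finite_subset by blast
  have "even_graph V'" using reach_even_graph V' V by blast
  \<comment> \<open>Only survivors in the union of \<open>X\<close> and \<open>F\<close> are offered
    for deletion, so gadgets yet to be used remain whole.\<close>
  then obtain W where W: "reach V' W" "V' - V' \<inter> (X \<union> F) \<subseteq> W"
    "\<forall>x\<in>W \<inter> (V' \<inter> (X \<union> F)). odd_deg W x"
    "\<forall>x\<in>W \<inter> (V' \<inter> (X \<union> F)). \<forall>y\<in>W \<inter> (V' \<inter> (X \<union> F)). x \<noteq> y \<longrightarrow> adj x y"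
    using greedy[of V' "V' \<inter> (X \<union> F)"] fin' by auto
  have W': "W \<inter> (V' \<inter> (X \<union> F)) = W \<inter> (X \<union> F)" using reach_subset[OF W(1)] by auto
  have "card (W \<inter> F) \<le> 2"
    using W(4) unfolding W' by (intro gadget_clique_card[OF F]) auto
  moreover have "W \<inter> (X \<union> F) \<subseteq> (X - X0) \<union> (W \<inter> F)"
    using V'(2) reach_subset[OF W(1)] by auto
  then have "card (W \<inter> (X \<union> F)) \<le> card ((X - X0) \<union> (W \<inter> F))"
    using finX gadget_finite[OF F] by (intro card_mono) auto
  moreover have "\<dots> \<le> card (X - X0) + card (W \<inter> F)" by (rule card_Un_le)
  moreover have "card (X - X0) = card X - min 3 (card X)"
    using X0 finX by (simp add: card_Diff_subset finite_subset)
  ultimately have "card (W \<inter> (X \<union> F)) \<le> max 2 (card X - 1)" by linarith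
  moreover have "reach V W" using V'(1) W(1) by simp
  moreover have "V - (X \<union> F) \<subseteq> W" using V'(3) W(2) As(4) X0(1) by blast
  ultimately show thesis using that W(3) unfolding W' by blast
qed

text \<open>Deleting an odd-degree vertex from an even graph would leave an odd number of edges, but
  at most one vertex remains and it spans no edge.\<close>

lemma small_odd_graph_empty:
  assumes "finite W" "card W \<le> 2" "even_graph W" "\<forall>x\<in>W. odd_deg W x"
  shows "W = {}"
proof (rule ccontr)
  assume "W \<noteq> {}"
  then obtain x where x: "x \<in> W" by auto
  have "even_graph (W - {x})"
  proof (cases "W - {x} = {}")
    case True
    show ?thesis unfolding True by (rule even_graph_empty)
  next
    case False
    have "card (W - {x}) \<le> 1" using assms(1,2) x by simp
    moreover have "card (W - {x}) \<noteq> 0" using False assms(1) by (metis card_0_eq finite_Diff)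
    ultimately have "card (W - {x}) = 1" by linarith
    then obtain y where y: "W - {x} = {y}" using card_1_singletonE by blast
    have no_loop: "{w \<in> {y}. adj y w} = {}" by auto
    have "\<not> odd_deg {y} y" unfolding odd_deg_def no_loop by simp
    then show ?thesis
      using even_graph_remove[of "{y}" y] by (auto simp: y even_graph_empty)
  qed
  then show False
    using even_graph_remove[of W x] assms x by auto
qed

text \<open>Using one gadget lowers the bound \<open>length gs + 1\<close> by one, and the leftover
  keeps up with it. When only the last gadget remains, the leftover has at most two vertices, which
  \<open>gadget_absorb\<close> preserves while making all their degrees odd.\<close>

lemma gadgets_reach_empty:
  assumes "finite X" "even_graph (X \<union> \<Union>(set gs))" "\<forall>F\<in>set gs. gadget F \<and> F \<inter> X = {}"
    "pairwise disjnt (set gs)" "distinct gs" "gs \<noteq> []" "card X \<le> length gs + 1"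
  shows "reach (X \<union> \<Union>(set gs)) {}"
  using assms
proof (induction gs arbitrary: X)
  case Nil
  then show ?case by simp
next
  case (Cons F gs)
  define V where "V = X \<union> \<Union>(set (F # gs))"
  define R where "R = \<Union>(set gs)"
  have disj: "F \<inter> B = {}" if "B \<in> set gs" for B
    using Cons.prems(4,5) that by (auto simp: pairwise_insert disjnt_def)
  have VR: "V = X \<union> F \<union> R" and Rd: "R \<inter> (X \<union> F) = {}"
    unfolding V_def R_def using disj Cons.prems(3) by auto
  have finV: "finite V"
    unfolding V_def using Cons.prems(1,3) gadget_finite by auto
  have evV: "even_graph V" using Cons.prems(2) by (simp add: V_def)
  have F: "gadget F" "X \<inter> F = {}" using Cons.prems(3) by auto
  obtain W where W: "reach V W" "V - (X \<union> F) \<subseteq> W" "card (W \<inter> (X \<union> F)) \<le> max 2 (card X - 1)"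
    "\<forall>x\<in>W \<inter> (X \<union> F). odd_deg W x"
    using gadget_absorb[OF finV evV _ _ F(2,1)] VR by blast
  define X' where "X' = W \<inter> (X \<union> F)"
  have WX: "W = X' \<union> R" unfolding X'_def using VR Rd W(2) reach_subset[OF W(1)] by auto
  have evW: "even_graph W" using reach_even_graph W evV by blast
  have finW: "finite W" using finV reach_subset[OF W(1)] finite_subset by blast
  have "reach W {}"
  proof (cases "gs = []")
    case True
    then have "W = X'" using WX by (simp add: R_def)
    moreover have "card X' \<le> 2" using W(3) Cons.prems(7) True by (simp add: X'_def)
    ultimately show ?thesis
      using small_odd_graph_empty[of W] finW evW W(4) by (auto simp: X'_def)
  next
    case False
    have "reach (X' \<union> \<Union>(set gs)) {}"
    proof (rule Cons.IH)
      show "finite X'" using finW by (simp add: X'_def)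
      show "even_graph (X' \<union> \<Union>(set gs))" using evW WX by (simp add: R_def)
      show "\<forall>B\<in>set gs. gadget B \<and> B \<inter> X' = {}"
        using Cons.prems(3) Rd by (auto simp: X'_def R_def)
      show "card X' \<le> length gs + 1"
        using W(3) Cons.prems(7) False by (cases gs) (auto simp: X'_def)
    qed (use Cons.prems False in \<open>auto simp: pairwise_insert\<close>)
    then show ?thesis using WX by (simp add: R_def)
  qed
  then show ?case using W(1) unfolding V_def by simp
qed

section \<open>Covering almost all vertices by disjoint gadgets\<close>

lemma disjoint_gadgets:
  assumes "finite V" "\<And>W. W \<subseteq> V \<Longrightarrow> card W = k \<Longrightarrow> \<exists>F\<subseteq>W. gadget F"
  shows "\<exists>gs. (\<forall>F\<in>set gs. gadget F \<and> F \<subseteq> V) \<and> pairwise disjnt (set gs) \<and> distinct gs \<and>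
            card V < k + 12 * length gs"
  using assms
proof (induction "card V" arbitrary: V rule: less_induct)
  case less
  show ?case
  proof (cases "card V < k")
    case True
    then show ?thesis by (intro exI[of _ "[]"]) auto
  next
    case False
    then obtain W where W: "W \<subseteq> V" "card W = k"
      using obtain_subset_with_card_n[of k V] by auto
    obtain F where F: "F \<subseteq> V" "gadget F"
      using less.prems(2)[OF W] W(1) by (meson subset_trans)
    have cF: "card (V - F) + 12 = card V"
      using F gadget_card gadget_finite less.prems(1) card_mono[of V F]
      by (simp add: card_Diff_subset)
    have sub: "\<exists>F\<subseteq>W. gadget F" if "W \<subseteq> V - F" "card W = k" for W
      using less.prems(2)[OF _ that(2)] that(1) by blast
    have "card (V - F) < card V" "finite (V - F)" using cF less.prems(1) by auto
    from less.hyps[OF this sub]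
    obtain gs where gs: "\<forall>B\<in>set gs. gadget B \<and> B \<subseteq> V - F" "pairwise disjnt (set gs)"
      "distinct gs" "card (V - F) < k + 12 * length gs"
      by blast
    have "F \<noteq> {}" using gadget_card[OF F(2)] by auto
    then have "F \<notin> set gs" using gs(1) by auto
    moreover have "pairwise disjnt (set (F # gs))"
      using gs(1,2) by (auto simp: pairwise_insert disjnt_def)
    moreover have "card V < k + 12 * length (F # gs)" using cF gs(4) by simp
    ultimately show ?thesis
      using gs F by (intro exI[of _ "F # gs"]) auto
  qed
qed

lemma reach_empty_if_gadgets:
  assumes "even_graph {..<n}" "n \<ge> 20"
    and "\<And>W. W \<subseteq> {..<n} \<Longrightarrow> card W = n div 20 \<Longrightarrow> \<exists>F\<subseteq>W. gadget F"
  shows "reach {..<n} {}"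
proof -
  obtain gs where gs: "\<forall>F\<in>set gs. gadget F \<and> F \<subseteq> {..<n}" "pairwise disjnt (set gs)"
    "distinct gs" "n < n div 20 + 12 * length gs"
    using disjoint_gadgets[OF _ assms(3), of "{..<n}"] by auto
  define X where "X = {..<n} - \<Union>(set gs)"
  have XV: "X \<union> \<Union>(set gs) = {..<n}" using gs(1) by (auto simp: X_def)
  have "card (\<Union>(set gs)) = (\<Sum>F\<in>set gs. card F)"
    using gs(1,2) gadget_finite by (intro card_Union_disjoint) auto
  also have "\<dots> = (\<Sum>F\<in>set gs. 12)" using gs(1) gadget_card by (intro sum.cong) auto
  also have "\<dots> = 12 * length gs" using gs(3) by (simp add: distinct_card)
  finally have "card X = n - 12 * length gs"
    unfolding X_def using gs(1) gadget_finite by (subst card_Diff_subset) auto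
  \<comment> \<open>Fewer than \<open>n div 20\<close> vertices are uncovered, whereas the gadgets
    number more than 19n/240, which exceeds n/20. A fraction a of uncovered vertices is affordable
    when (1 - a)/12 is at least a, that is, up to 1/13.\<close>
  then have "card X \<le> length gs + 1" using gs(4) assms(2) by linarith
  moreover have "gs \<noteq> []" using gs(4) by auto
  moreover have "even_graph (X \<union> \<Union>(set gs))" using assms(1) unfolding XV .
  moreover have "finite X" "\<forall>F\<in>set gs. gadget F \<and> F \<inter> X = {}" using gs(1) by (auto simp: X_def)
  ultimately have "reach (X \<union> \<Union>(set gs)) {}"
    using gs(2,3) by (intro gadgets_reach_empty)
  then show ?thesis by (simp add: XV)
qed

lemma even_decomposable_if_reach:
  assumes "reach {..<n} {}"
  shows "even_decomposable n E"
proof -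
  obtain k where "(step ^^ k) {..<n} {}" using assms by (auto simp: rtranclp_power)
  then obtain V where "V 0 = {..<n}" "V k = {}" "\<forall>i<k. step (V i) (V (Suc i))"
    unfolding relpowp_fun_conv by blast
  then show ?thesis
    unfolding even_decomposable_def step_def even_graph_def
    by (intro exI[of _ k] exI[of _ V]) simp
qed

end

lemma non_decomposable_no_gadget:
  assumes "E \<subseteq> all_pairs n" "even_non_decomposable n E" "n \<ge> 20"
  shows "\<exists>W\<subseteq>{..<n}. card W = n div 20 \<and> (\<forall>F\<subseteq>W. \<not> pair_graph.gadget E F)"
proof (rule ccontr)
  interpret pair_graph E
    using assms(1) by unfold_locales (auto simp: all_pairs_def)
  assume "\<not> ?thesis"
  moreover have "induced_edges E {..<n} = E"
    using assms(1) by (auto simp: induced_edges_def all_pairs_def)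
  then have "even_graph {..<n}"
    using assms(2) by (simp add: even_graph_def even_non_decomposable_def)
  ultimately have "even_decomposable n E"
    using assms(3) by (intro even_decomposable_if_reach reach_empty_if_gadgets) auto
  then show False using assms(2) by (simp add: even_non_decomposable_def)
qed

section \<open>Random subsets\<close>

text \<open>With \<open>S = all_pairs n\<close> this is \<open>gnp_prob\<close>; a general ground
  set makes it possible to split off blocks of pairs and treat them independently.\<close>

definition subset_prob :: "real \<Rightarrow> 'a set \<Rightarrow> ('a set \<Rightarrow> bool) \<Rightarrow> real" where
  "subset_prob p S P = (\<Sum>E | E \<subseteq> S \<and> P E. p ^ card E * (1 - p) ^ (card S - card E))"

lemma subset_prob_cong:
  "(\<And>E. E \<subseteq> S \<Longrightarrow> P E \<longleftrightarrow> Q E) \<Longrightarrow> subset_prob p S P = subset_prob p S Q"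
  unfolding subset_prob_def by (intro sum.cong) auto

lemma subset_prob_nonneg: "0 \<le> p \<Longrightarrow> p \<le> 1 \<Longrightarrow> 0 \<le> subset_prob p S P"
  unfolding subset_prob_def by (intro sum_nonneg) auto

lemma subset_prob_mono:
  assumes "finite S" "0 \<le> p" "p \<le> 1" "\<And>E. E \<subseteq> S \<Longrightarrow> P E \<Longrightarrow> Q E"
  shows "subset_prob p S P \<le> subset_prob p S Q"
  unfolding subset_prob_def using assms by (intro sum_mono2) auto

text \<open>Independence of the traces on disjoint blocks: a subset of the union corresponds to its
  pair of traces, and the weights multiply.\<close>

lemma subset_prob_Un:
  assumes "finite A" "finite B" "A \<inter> B = {}"
  shows "subset_prob p (A \<union> B) (\<lambda>E. P (E \<inter> A) \<and> Q (E \<inter> B)) = subset_prob p A P * subset_prob p B Q"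
proof -
  let ?w = "\<lambda>S E. p ^ card E * (1 - p) ^ (card S - card E)"
  have w: "?w (A \<union> B) (X \<union> Y) = ?w A X * ?w B Y" if "X \<subseteq> A" "Y \<subseteq> B" for X Y
  proof -
    have fin: "finite X" "finite Y" using that assms(1,2) by (auto intro: finite_subset)
    have "card (A \<union> B) = card A + card B" using assms by (simp add: card_Un_disjoint)
    moreover have "card (X \<union> Y) = card X + card Y"
      using fin that assms(3) by (intro card_Un_disjoint) auto
    moreover have "card X \<le> card A" "card Y \<le> card B" using that assms by (auto intro: card_mono)
    ultimately have "card (A \<union> B) - card (X \<union> Y) = (card A - card X) + (card B - card Y)"
      "card (X \<union> Y) = card X + card Y" by auto
    then show ?thesis by (simp add: power_add)
  qed
  have "subset_prob p A P * subset_prob p B Q =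
      (\<Sum>(X, Y)\<in>{X. X \<subseteq> A \<and> P X} \<times> {Y. Y \<subseteq> B \<and> Q Y}. ?w A X * ?w B Y)"
    by (simp add: subset_prob_def sum_product sum.cartesian_product)
  also have "\<dots> = (\<Sum>E | E \<subseteq> A \<union> B \<and> P (E \<inter> A) \<and> Q (E \<inter> B). ?w (A \<union> B) E)"
  proof (rule sum.reindex_bij_witness[where i = "\<lambda>E. (E \<inter> A, E \<inter> B)" and j = "\<lambda>(X, Y). X \<union> Y"],
      goal_cases)
    case (1 a)
    then show ?case using assms(3) by auto
  next
    case (2 a)
    then obtain X Y where "a = (X, Y)" "X \<subseteq> A" "Y \<subseteq> B" "P X" "Q Y" by auto
    moreover from this have "(X \<union> Y) \<inter> A = X" "(X \<union> Y) \<inter> B = Y" using assms(3) by auto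
    ultimately show ?case by auto
  next
    case (3 b)
    then show ?case by auto
  next
    case (4 b)
    then show ?case by auto
  next
    case (5 a)
    then show ?case using w by auto
  qed
  finally show ?thesis by (simp add: subset_prob_def)
qed

lemma subset_prob_True: "finite S \<Longrightarrow> subset_prob p S (\<lambda>_. True) = 1"
proof (induction S rule: finite_induct)
  case empty
  then show ?case by (simp add: subset_prob_def)
next
  case (insert x S)
  have "{E. E \<subseteq> {x}} = {{}, {x}}" by auto
  then have "subset_prob p {x} (\<lambda>_. True) = 1" by (simp add: subset_prob_def)
  then show ?case
    using subset_prob_Un[of "{x}" S p "\<lambda>_. True" "\<lambda>_. True"] insert by simp
qed

lemma subset_prob_neq:
  assumes "finite D" "T \<subseteq> D"
  shows "subset_prob p D (\<lambda>E. E \<noteq> T) = 1 - p ^ card T * (1 - p) ^ (card D - card T)"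
proof -
  have "{E. E \<subseteq> D} = insert T {E. E \<subseteq> D \<and> E \<noteq> T}" using assms(2) by auto
  moreover have "finite {E. E \<subseteq> D \<and> E \<noteq> T}" using assms(1) by auto
  ultimately have "subset_prob p D (\<lambda>_. True) =
      p ^ card T * (1 - p) ^ (card D - card T) + subset_prob p D (\<lambda>E. E \<noteq> T)"
    by (simp add: subset_prob_def)
  then show ?thesis using subset_prob_True[OF assms(1), of p] by simp
qed

lemma subset_prob_union_bound:
  assumes "finite S" "finite I" "0 \<le> p" "p \<le> 1"
  shows "subset_prob p S (\<lambda>E. \<exists>i\<in>I. P i E) \<le> (\<Sum>i\<in>I. subset_prob p S (P i))"
  using assms(2)
proof (induction I rule: finite_induct)
  case empty
  then show ?case by (simp add: subset_prob_def)
next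
  case (insert i I)
  let ?w = "\<lambda>E. p ^ card E * (1 - p) ^ (card S - card E)"
  let ?A = "{E. E \<subseteq> S \<and> P i E}" and ?B = "{E. E \<subseteq> S \<and> (\<exists>j\<in>I. P j E)}"
  have "{E. E \<subseteq> S \<and> (\<exists>j\<in>insert i I. P j E)} = ?A \<union> ?B" by auto
  moreover have "sum ?w (?A \<union> ?B) = sum ?w ?A + sum ?w ?B - sum ?w (?A \<inter> ?B)"
    using assms(1) by (intro sum_Un) auto
  moreover have "sum ?w (?A \<inter> ?B) \<ge> 0" using assms(3,4) by (intro sum_nonneg) auto
  ultimately have "subset_prob p S (\<lambda>E. \<exists>j\<in>insert i I. P j E) \<le>
      subset_prob p S (P i) + subset_prob p S (\<lambda>E. \<exists>j\<in>I. P j E)"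
    by (simp add: subset_prob_def)
  then show ?case using insert by simp
qed

text \<open>The blocks \<open>D i\<close> are disjoint, so the events are independent, and each
  prescribed trace \<open>T i\<close> occurs with probability at least \<open>q ^ m\<close>. The
  induction splits off one block at a time.\<close>

lemma subset_prob_avoid_patterns:
  assumes "finite I" "finite S" "\<And>i. i \<in> I \<Longrightarrow> T i \<subseteq> D i \<and> D i \<subseteq> S \<and> card (D i) \<le> m"
    and "\<And>i j. i \<in> I \<Longrightarrow> j \<in> I \<Longrightarrow> i \<noteq> j \<Longrightarrow> D i \<inter> D j = {}"
    and q: "0 < q" "q \<le> p" "p \<le> 1 - q"
  shows "subset_prob p S (\<lambda>E. \<forall>i\<in>I. E \<inter> D i \<noteq> T i) \<le> (1 - q ^ m) ^ card I"
  using assms(1-4)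
proof (induction I arbitrary: S rule: finite_induct)
  case empty
  then show ?case by (simp add: subset_prob_True)
next
  case (insert i I)
  have Di: "T i \<subseteq> D i" "D i \<subseteq> S" "card (D i) \<le> m" using insert.prems(2)[of i] by auto
  then have fin: "finite (D i)" using insert.prems(1) finite_subset by blast
  have disj: "D i \<inter> D j = {}" if "j \<in> I" for j
    using insert.prems(3)[of i j] insert.hyps that by auto
  have "subset_prob p S (\<lambda>E. \<forall>j\<in>insert i I. E \<inter> D j \<noteq> T j) =
      subset_prob p (D i \<union> (S - D i))
        (\<lambda>E. E \<inter> D i \<noteq> T i \<and> (\<forall>j\<in>I. E \<inter> (S - D i) \<inter> D j \<noteq> T j))"
  proof -
    have restrict: "E \<inter> (S - D i) \<inter> D j = E \<inter> D j" if "E \<subseteq> S" "j \<in> I" for E j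
      using that disj[of j] by auto
    have S: "D i \<union> (S - D i) = S" using Di by auto
    show ?thesis unfolding S by (rule subset_prob_cong) (simp add: restrict)
  qed
  also have "\<dots> = subset_prob p (D i) (\<lambda>E. E \<noteq> T i) *
      subset_prob p (S - D i) (\<lambda>E. \<forall>j\<in>I. E \<inter> D j \<noteq> T j)"
    using subset_prob_Un[of "D i" "S - D i" p "\<lambda>E. E \<noteq> T i" "\<lambda>E. \<forall>j\<in>I. E \<inter> D j \<noteq> T j"]
      fin insert.prems(1) by simp
  also have "\<dots> \<le> (1 - q ^ m) * (1 - q ^ m) ^ card I"
  proof (intro mult_mono)
    have "card (T i) \<le> card (D i)" using Di(1) fin by (rule card_mono[rotated])
    \<comment> \<open>Every element of the block contributes a factor \<open>p\<close> or
      \<open>1 - p\<close>, both at least \<open>q\<close>.\<close>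
    then have "q ^ card (D i) = q ^ card (T i) * q ^ (card (D i) - card (T i))"
      by (simp flip: power_add)
    also have "\<dots> \<le> p ^ card (T i) * (1 - p) ^ (card (D i) - card (T i))"
      using q by (intro mult_mono power_mono) auto
    moreover have "q ^ m \<le> q ^ card (D i)" using q Di by (intro power_decreasing) auto
    ultimately show "subset_prob p (D i) (\<lambda>E. E \<noteq> T i) \<le> 1 - q ^ m"
      unfolding subset_prob_neq[OF fin Di(1)] by linarith
    have "D j \<subseteq> S - D i" if "j \<in> I" for j using disj[OF that] insert.prems(2)[of j] that by auto
    then show "subset_prob p (S - D i) (\<lambda>E. \<forall>j\<in>I. E \<inter> D j \<noteq> T j) \<le> (1 - q ^ m) ^ card I"
      using insert.prems by (intro insert.IH) auto
    show "0 \<le> 1 - q ^ m" using q by (simp add: power_le_one)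
  qed (use q in \<open>auto intro: subset_prob_nonneg\<close>)
  finally show ?case using insert.hyps by simp
qed

section \<open>Gadgets in random graphs\<close>

text \<open>These pairs form the block, and \<open>placement_edges\<close> the trace on it, to which
  \<open>subset_prob_avoid_patterns\<close> is applied. A gadget is induced, so nonedges are
  prescribed along with edges.\<close>

definition placement_pairs :: "(nat \<Rightarrow> nat) \<Rightarrow> nat set set" where
  "placement_pairs f = {{f i, f j} | i j. i < 12 \<and> j < 12 \<and> i \<noteq> j}"

definition placement_edges :: "(nat \<Rightarrow> nat) \<Rightarrow> nat set set" where
  "placement_edges f = {{f i, f j} | i j. i < 12 \<and> j < 12 \<and> i \<noteq> j \<and> i div 2 = j div 2}"

lemma card_placement_pairs: "card (placement_pairs f) \<le> 144"
proof -
  \<comment> \<open>A crude count by ordered pairs of indices, 12 * 12 of them.\<close>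
  have "placement_pairs f \<subseteq> (\<lambda>(i, j). {f i, f j}) ` ({..<12} \<times> {..<12})"
    by (auto simp: placement_pairs_def)
  then have "card (placement_pairs f) \<le> card ({..<12::nat} \<times> {..<12::nat})"
    by (intro surj_card_le) auto
  then show ?thesis by simp
qed

lemma (in pair_graph) gadget_placement:
  assumes "inj_on f {..<12}" "E \<inter> placement_pairs f = placement_edges f"
  shows "gadget (f ` {..<12})"
proof -
  have "adj (f i) (f j) \<longleftrightarrow> i \<noteq> j \<and> i div 2 = j div 2" if ij: "i < 12" "j < 12" for i j
  proof (cases "i = j")
    case False
    then have "{f i, f j} \<in> placement_pairs f" using ij by (auto simp: placement_pairs_def)
    then have "adj (f i) (f j) \<longleftrightarrow> {f i, f j} \<in> placement_edges f" using assms(2) by blast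
    also have "\<dots> \<longleftrightarrow> i div 2 = j div 2"
    proof
      assume "{f i, f j} \<in> placement_edges f"
      then obtain k l where kl: "{f i, f j} = {f k, f l}" "k < 12" "l < 12" "k div 2 = l div 2"
        by (auto simp: placement_edges_def)
      then have "(i = k \<and> j = l) \<or> (i = l \<and> j = k)"
        using assms(1) ij by (auto simp: doubleton_eq_iff inj_on_def)
      then show "i div 2 = j div 2" using kl by auto
    qed (use False ij in \<open>auto simp: placement_edges_def\<close>)
    finally show ?thesis using False by simp
  qed simp
  then show ?thesis using assms(1) by (auto simp: gadget_def)
qed

text \<open>Placements need only avoid sharing pairs; they may share vertices. This is what fits
  quadratically many of them into linearly many vertices and produces an exponent of order n
  squared.\<close>

lemma edge_disjoint_placements:
  assumes "finite W" "144 * t \<le> card W"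
  obtains f :: "nat \<times> nat \<Rightarrow> nat \<Rightarrow> nat" where
    "\<And>s. s \<in> {..<t} \<times> {..<t} \<Longrightarrow> inj_on (f s) {..<12} \<and> f s ` {..<12} \<subseteq> W"
    "\<And>s s'. s \<in> {..<t} \<times> {..<t} \<Longrightarrow> s' \<in> {..<t} \<times> {..<t} \<Longrightarrow> s \<noteq> s' \<Longrightarrow>
       placement_pairs (f s) \<inter> placement_pairs (f s') = {}"
proof -
  have "card ({..<12::nat} \<times> {..<12 * t}) \<le> card W" using assms by simp
  then obtain w :: "nat \<times> nat \<Rightarrow> nat" where
    w: "w ` ({..<12} \<times> {..<12 * t}) \<subseteq> W" "inj_on w ({..<12} \<times> {..<12 * t})"
    using card_le_inj[of "{..<12::nat} \<times> {..<12 * t}" W] assms(1) by auto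
  \<comment> \<open>Lines in a grid with twelve columns: two of them meet in at most one point. Columns of
    height \<open>12 * t\<close> make room for all slopes and intercepts below \<open>t\<close> without modular arithmetic.\<close>
  define f where "f s i = w (i, fst s + i * snd s)" for s i
  have dom: "(i, fst s + i * snd s) \<in> {..<12} \<times> {..<12 * t}"
    if "s \<in> {..<t} \<times> {..<t}" "i < 12" for s i
  proof -
    have "i * snd s \<le> 11 * snd s" using that by (intro mult_le_mono1) simp
    moreover have "fst s < t" "snd s < t" using that(1) by auto
    ultimately have "fst s + i * snd s < 12 * t" by linarith
    then show ?thesis using that(2) by simp
  qed
  have f_eq: "i = j \<and> fst s + i * snd s = fst s' + j * snd s'"
    if "s \<in> {..<t} \<times> {..<t}" "s' \<in> {..<t} \<times> {..<t}" "i < 12" "j < 12" "f s i = f s' j" for s s' i j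
  proof -
    have "(i, fst s + i * snd s) = (j, fst s' + j * snd s')"
      using that(5) unfolding f_def by (rule inj_onD[OF w(2) _ dom[OF that(1,3)] dom[OF that(2,4)]])
    then show ?thesis unfolding prod.inject .
  qed
  have lines: "s = s'" if "fst s + i * snd s = fst s' + i * snd s'"
    "fst s + j * snd s = fst s' + j * snd s'" "i \<noteq> j"
    for s s' :: "nat \<times> nat" and i j :: nat
  proof -
    \<comment> \<open>Subtracting the two incidence equations, over the integers to avoid truncated
      subtraction, leaves the column difference times the slope difference.\<close>
    have "(int i - int j) * (int (snd s) - int (snd s')) =
        (int (fst s + i * snd s) - int (fst s' + i * snd s')) -
        (int (fst s + j * snd s) - int (fst s' + j * snd s'))"
      by (simp add: algebra_simps)
    also have "\<dots> = 0" using that by simp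
    finally have "snd s = snd s'" using that(3) by simp
    then show ?thesis using that(1) by (simp add: prod_eq_iff)
  qed
  show thesis
  proof (rule that[of f])
    fix s assume s: "s \<in> {..<t} \<times> {..<t}"
    show "inj_on (f s) {..<12} \<and> f s ` {..<12} \<subseteq> W"
      using f_eq[OF s s] dom[OF s] w(1) by (force simp: inj_on_def f_def)
  next
    fix s s' assume s: "s \<in> {..<t} \<times> {..<t}" "s' \<in> {..<t} \<times> {..<t}" and ne: "s \<noteq> s'"
    show "placement_pairs (f s) \<inter> placement_pairs (f s') = {}"
    proof (rule ccontr)
      assume "\<not> ?thesis"
      then obtain i j k l where ij: "i < 12" "j < 12" "i \<noteq> j" "k < 12" "l < 12"
        "{f s i, f s j} = {f s' k, f s' l}"
        by (auto simp: placement_pairs_def)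
      then have "(f s i = f s' k \<and> f s j = f s' l) \<or> (f s i = f s' l \<and> f s j = f s' k)"
        by (simp add: doubleton_eq_iff)
      \<comment> \<open>A point determines its column, so in either matching of the endpoints the
        two lines meet in both columns \<open>i\<close> and \<open>j\<close>.\<close>
      then have "fst s + i * snd s = fst s' + i * snd s'" "fst s + j * snd s = fst s' + j * snd s'"
        using f_eq[OF s] ij by metis+
      then show False using lines ij(3) ne by blast
    qed
  qed
qed

lemma no_gadget_prob:
  assumes "W \<subseteq> {..<n}" "144 * t \<le> card W" and q: "0 < q" "q \<le> p" "p \<le> 1 - q"
  shows "subset_prob p (all_pairs n) (\<lambda>E. \<forall>F\<subseteq>W. \<not> pair_graph.gadget E F) \<le> (1 - q ^ 144) ^ (t\<^sup>2)"
proof -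
  have "finite W" using assms(1) finite_subset by blast
  then obtain f :: "nat \<times> nat \<Rightarrow> nat \<Rightarrow> nat" where
    f: "\<And>s. s \<in> {..<t} \<times> {..<t} \<Longrightarrow> inj_on (f s) {..<12} \<and> f s ` {..<12} \<subseteq> W" and
    disj: "\<And>s s'. s \<in> {..<t} \<times> {..<t} \<Longrightarrow> s' \<in> {..<t} \<times> {..<t} \<Longrightarrow> s \<noteq> s' \<Longrightarrow>
       placement_pairs (f s) \<inter> placement_pairs (f s') = {}"
    using edge_disjoint_placements[of W t] assms(2) by blast
  have fin: "finite (all_pairs n)"
    by (rule finite_subset[of _ "Pow {..<n}"]) (auto simp: all_pairs_def)
  have "subset_prob p (all_pairs n) (\<lambda>E. \<forall>F\<subseteq>W. \<not> pair_graph.gadget E F) \<le>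
    subset_prob p (all_pairs n)
      (\<lambda>E. \<forall>s\<in>{..<t} \<times> {..<t}. E \<inter> placement_pairs (f s) \<noteq> placement_edges (f s))"
  proof (intro subset_prob_mono fin ballI notI)
    fix E s assume E: "E \<subseteq> all_pairs n" "\<forall>F\<subseteq>W. \<not> pair_graph.gadget E F"
      and s: "s \<in> {..<t} \<times> {..<t}" "E \<inter> placement_pairs (f s) = placement_edges (f s)"
    interpret pair_graph E
      using E(1) by unfold_locales (auto simp: all_pairs_def)
    show False using gadget_placement[OF _ s(2)] f[OF s(1)] E(2) by blast
  qed (use q in auto)
  also have "\<dots> \<le> (1 - q ^ 144) ^ card ({..<t} \<times> {..<t})"
  proof (rule subset_prob_avoid_patterns[OF _ fin _ disj q])
    fix s assume s: "s \<in> {..<t} \<times> {..<t}"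
    have "card {f s i, f s j} = 2" if "i < 12" "j < 12" "i \<noteq> j" for i j
      using f[OF s] that by (auto simp: card_2_iff inj_on_def)
    moreover have "f s i < n" if "i < 12" for i using f[OF s] assms(1) that by auto
    ultimately have "placement_pairs (f s) \<subseteq> all_pairs n"
      by (auto simp: placement_pairs_def all_pairs_def)
    then show "placement_edges (f s) \<subseteq> placement_pairs (f s) \<and>
        placement_pairs (f s) \<subseteq> all_pairs n \<and> card (placement_pairs (f s)) \<le> 144"
      using card_placement_pairs by (auto simp: placement_edges_def placement_pairs_def)
  qed simp_all
  finally show ?thesis by (simp add: power2_eq_square)
qed

text \<open>A union bound over the at most \<open>2 ^ n\<close> candidate sets without a gadget. The
  divisor is 2880 = 20 * 144, so that \<open>t = n div 2880\<close> satisfies the size condition of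
  \<open>no_gadget_prob\<close> for sets of \<open>n div 20\<close> vertices.\<close>

lemma non_decomposable_prob:
  assumes q: "0 < q" "q \<le> p" "p \<le> 1 - q" and n: "n \<ge> 20"
  shows "gnp_prob n p (even_non_decomposable n) \<le> 2 ^ n * (1 - q ^ 144) ^ ((n div 2880)\<^sup>2)"
proof -
  define \<W> where "\<W> = {W. W \<subseteq> {..<n} \<and> card W = n div 20}"
  define B where "B = (1 - q ^ 144) ^ ((n div 2880)\<^sup>2)"
  have B: "B \<ge> 0" unfolding B_def using q by (simp add: power_le_one)
  have fin: "finite (all_pairs n)"
    by (rule finite_subset[of _ "Pow {..<n}"]) (auto simp: all_pairs_def)
  have finW: "finite \<W>" unfolding \<W>_def by simp
  have "card \<W> \<le> card (Pow {..<n})" unfolding \<W>_def by (intro card_mono) auto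
  then have cW: "real (card \<W>) \<le> 2 ^ n"
    by (simp add: card_Pow flip: of_nat_power_le_of_nat_cancel_iff)
  have "gnp_prob n p (even_non_decomposable n) = subset_prob p (all_pairs n) (even_non_decomposable n)"
    by (simp add: gnp_prob_def subset_prob_def)
  also have "\<dots> \<le> subset_prob p (all_pairs n) (\<lambda>E. \<exists>W\<in>\<W>. \<forall>F\<subseteq>W. \<not> pair_graph.gadget E F)"
  proof (rule subset_prob_mono[OF fin])
    fix E assume "E \<subseteq> all_pairs n" "even_non_decomposable n E"
    then show "\<exists>W\<in>\<W>. \<forall>F\<subseteq>W. \<not> pair_graph.gadget E F"
      using non_decomposable_no_gadget[of E n] n unfolding \<W>_def by blast
  qed (use q in auto)
  also have "\<dots> \<le> (\<Sum>W\<in>\<W>. subset_prob p (all_pairs n) (\<lambda>E. \<forall>F\<subseteq>W. \<not> pair_graph.gadget E F))"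
    using q by (intro subset_prob_union_bound fin finW) auto
  also have "\<dots> \<le> (\<Sum>W\<in>\<W>. B)"
    unfolding B_def by (intro sum_mono no_gadget_prob q) (auto simp: \<W>_def)
  also have "\<dots> \<le> 2 ^ n * B" using cW B by (simp add: mult_right_mono)
  finally show ?thesis by (simp add: B_def)
qed

section \<open>The final estimate: quadratic decay beats the union bound\<close>

lemma quadratic_decay:
  fixes \<epsilon> :: real
  assumes "0 < \<epsilon>" "\<epsilon> \<le> 1"
  shows "\<exists>c>0. \<exists>n0. \<forall>n\<ge>n0. 2 ^ n * (1 - \<epsilon>) ^ ((n div 2880)\<^sup>2) \<le> exp (- c * (real n)\<^sup>2)"
proof -
  \<comment> \<open>This makes the exponent gained at least twice \<open>c * n^2\<close>: one half
    pays for \<open>2 ^ n\<close> once \<open>n\<close> is at least \<open>1 / c\<close>, and the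
    other half remains.\<close>
  define c where "c = \<epsilon> / (2 * 5760\<^sup>2)"
  have c: "c > 0" using assms by (simp add: c_def)
  have "2 ^ n * (1 - \<epsilon>) ^ ((n div 2880)\<^sup>2) \<le> exp (- c * (real n)\<^sup>2)"
    if n: "n \<ge> max 5760 (nat \<lceil>1 / c\<rceil>)" for n
  proof -
    define t where "t = n div 2880"
    \<comment> \<open>As \<open>t\<close> is at least 1, \<open>n < 2880 * (t + 1)\<close> is at
      most \<open>5760 * t\<close>; the factor two absorbs the rounding.\<close>
    have "n \<le> 5760 * t" using n unfolding t_def by linarith
    then have "real n \<le> 5760 * real t" by linarith
    then have "(real n)\<^sup>2 \<le> (5760 * real t)\<^sup>2" by (intro power_mono) auto
    then have t: "\<epsilon> * real (t\<^sup>2) \<ge> 2 * c * (real n)\<^sup>2"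
      using assms by (simp add: c_def field_simps power_mult_distrib)
    have "1 / c \<le> real n" using n by linarith
    then have "real n * 1 \<le> real n * (c * real n)"
      using c by (intro mult_left_mono) (auto simp: field_simps)
    then have n': "real n \<le> c * (real n)\<^sup>2" by (simp add: power2_eq_square algebra_simps)
    have "(2::real) \<le> exp 1" using exp_ge_add_one_self[of 1] by simp
    then have "2 ^ n \<le> exp (1::real) ^ n" by (intro power_mono) auto
    moreover have "(1 - \<epsilon>) ^ (t\<^sup>2) \<le> exp (- \<epsilon>) ^ (t\<^sup>2)"
      using assms exp_ge_add_one_self[of "- \<epsilon>"] by (intro power_mono) auto
    ultimately have "2 ^ n * (1 - \<epsilon>) ^ (t\<^sup>2) \<le> exp 1 ^ n * exp (- \<epsilon>) ^ (t\<^sup>2)"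
      using assms by (intro mult_mono) auto
    also have "\<dots> = exp (real n - \<epsilon> * real (t\<^sup>2))"
      by (simp add: exp_diff exp_minus field_simps flip: exp_of_nat_mult)
    also have "\<dots> \<le> exp (- c * (real n)\<^sup>2)" using t n' by simp
    finally show ?thesis by (simp add: t_def)
  qed
  then show ?thesis using c by blast
qed

theorem mainTheorem1:
  shows "\<exists>c::real. c > 0 \<and> (\<exists>n0::nat. \<forall>n\<ge>n0. \<forall>p::real.
           10 powr (-6) \<le> p \<and> p \<le> 1 - 10 powr (-6) \<longrightarrow>
           gnp_prob n p (even_non_decomposable n) \<le> exp (- c * (real n)\<^sup>2))"
proof -
  define q :: real where "q = 10 powr (-6)"
  have q: "0 < q" "q \<le> 1" unfolding q_def by (auto simp: powr_minus field_simps)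
  \<comment> \<open>These depend on \<open>q\<close> alone and therefore serve all \<open>p\<close>
    between \<open>q\<close> and \<open>1 - q\<close>.\<close>
  then obtain c n0 where c: "c > 0"
    "\<And>n. n \<ge> n0 \<Longrightarrow> 2 ^ n * (1 - q ^ 144) ^ ((n div 2880)\<^sup>2) \<le> exp (- c * (real n)\<^sup>2)"
    using quadratic_decay[of "q ^ 144"] by (auto simp: power_le_one)
  have "gnp_prob n p (even_non_decomposable n) \<le> exp (- c * (real n)\<^sup>2)"
    if "n \<ge> max n0 20" "q \<le> p" "p \<le> 1 - q" for n p
    using non_decomposable_prob[of q p n] c(2)[of n] q that by simp
  then show ?thesis
    using c(1) unfolding q_def by blast
qed

end
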